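(* Let $q$ be a prime power with $q\equiv 1 \pmod 4$ and $q>2809$, and let $n=1+\frac{q-1}{2}$. Then there exists an element of $\mathbb{F}_q$ that cannot be written as $\alpha+\beta$ with $\alpha\in C_5$ and $\beta\in C_n$.
   Context: For a prime power $q$ and an integer $k>1$, an element $a\in\mathbb{F}_q$ is called a $k$-potent if $a^k=a$, and $C_k$ denotes the set of all $k$-potents in $\mathbb{F}_q$. For $q\equiv 1\pmod 4$ one has $C_5=\{0,\pm1,\pm\zeta\}$ with $\zeta^2=-1$. For $n=1+(q-1)/2$, $C_n$ is the set of squares in $\mathbb{F}_q$, including $0$. *)

theory Defs
  imports Main
begin

definition kpotents :: "nat \<Rightarrow> 'a::field set" where
  "kpotents k = {a. a ^ k = a}"

end

(*
  Let chi be the quadratic character and z^2 = -1. An element that is no sum as described is an x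
  with chi (x - a) = -1 for all a in {0, 1, -1, z, -z}, so it suffices to show that the sum over x
  of the product of the factors 1 - chi (x - a) is nonzero. Expanding gives character sums of
  polynomials of degree at most 5. The substitutions x -> z x and x -> 1/x relate them to each other
  and make most of them cancel, which leaves q - 15, the sums U and V of chi (x (x^k - 1)) for
  k = 2, 4, and four times a single cubic sum.

  No Weil bound is needed. The second moment over c of the sums of chi (x (x^k - c)) gives
  U^2 <= 4 q and V^2 <= 16 q. For a cubic sum T with distinct roots, the parametrisation
  x = h + k, y = h - k of pairs turns T^2 into a sum over h of Legendre sums whose parameter is a
  rational function of h of degree 3. Cauchy-Schwarz and the second moment of the Legendre family
  give T^4 <= 6 q^3, which is just strong enough for q > 2809 = 53^2.
*)

theory Submission
  imports Defs "HOL-Computational_Algebra.Polynomial"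
begin

subsection \<open>Elementary facts on finite sums and finite fields\<close>

text \<open>Cauchy-Schwarz against the constant 1: the right side minus the left side is half the
  double sum of \<open>(f x - f y)\<^sup>2\<close>.\<close>

lemma sum_squared_le_card_sum_squares:
  fixes f :: "'b \<Rightarrow> int"
  assumes "finite A"
  shows "(\<Sum>x\<in>A. f x)\<^sup>2 \<le> int (card A) * (\<Sum>x\<in>A. (f x)\<^sup>2)"
proof -
  have "0 \<le> (\<Sum>x\<in>A. \<Sum>y\<in>A. (f x - f y)\<^sup>2)"
    by (intro sum_nonneg) simp
  also have "\<dots> = 2 * (int (card A) * (\<Sum>x\<in>A. (f x)\<^sup>2)) - 2 * ((\<Sum>x\<in>A. f x) * (\<Sum>x\<in>A. f x))"
    by (simp add: power2_diff sum_subtractf sum.distrib sum_product mult.assoc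
        flip: sum_distrib_left)
  finally show ?thesis
    by (simp add: power2_eq_square)
qed

text \<open>Turns a second moment over a parameter into a bound along a map with small fibres:
  \<open>d ^ k\<close> in one application, a rational function of degree 3 in the other.\<close>

lemma sum_comp_le:
  fixes g :: "'c \<Rightarrow> int"
  assumes "finite A" "finite B" "f ` A \<subseteq> B"
    and "\<And>y. y \<in> B \<Longrightarrow> 0 \<le> g y"
    and "\<And>y. y \<in> B \<Longrightarrow> card {x \<in> A. f x = y} \<le> k"
  shows "(\<Sum>x\<in>A. g (f x)) \<le> int k * (\<Sum>y\<in>B. g y)"
  unfolding sum_fun_comp[OF assms(1-3)] sum_distrib_left
  by (intro sum_mono mult_right_mono) (use assms in auto)

lemma card_power_eq_le:
  fixes c :: "'a::idom"
  assumes "k > 0"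
  shows "card {x. x ^ k = c} \<le> k"
proof -
  let ?p = "monom 1 k + [:- c:]"
  have deg: "degree ?p = k"
    using assms by (subst degree_add_eq_left) (simp_all add: degree_monom_eq)
  then have "?p \<noteq> 0"
    using assms by force
  from card_poly_roots_bound[OF this] show ?thesis
    by (simp add: deg poly_monom)
qed

text \<open>Multiplication by \<open>x\<close> permutes the nonzero elements, so their nonzero
  product is unchanged when it is multiplied by this power of \<open>x\<close>.\<close>

lemma power_card_minus_one:
  fixes x :: "'a::{finite,field}"
  assumes "x \<noteq> 0"
  shows "x ^ (card (UNIV :: 'a set) - 1) = 1"
proof -
  have "(\<Prod>y\<in>-{0}. y) = (\<Prod>y\<in>-{0}. x * y)"
    by (rule prod.reindex_bij_witness[of _ "\<lambda>y. x * y" "\<lambda>y. y / x"]) (use assms in auto)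
  also have "\<dots> = x ^ (card (UNIV :: 'a set) - 1) * (\<Prod>y\<in>-{0}. y)"
    by (simp add: prod.distrib Compl_eq_Diff_UNIV)
  finally show ?thesis
    by simp
qed

lemma product_fourth_roots_of_unity:
  fixes x z :: "'a::idom"
  assumes "z * z = - 1"
  shows "(x - 1) * (x + 1) * (x - z) * (x + z) = x ^ 4 - 1"
  using assms by algebra

lemma sum_affine:
  fixes a b :: "'a::{finite,field}"
  assumes "a \<noteq> 0"
  shows "(\<Sum>x\<in>UNIV. f (a * x + b)) = (\<Sum>x\<in>UNIV. f x)"
  by (rule sum.reindex_bij_witness[of _ "\<lambda>x. (x - b) / a" "\<lambda>x. a * x + b"]) (use assms in auto)

lemma sum_inverse:
  fixes f :: "'a::{finite,field} \<Rightarrow> int"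
  shows "(\<Sum>x\<in>-{0}. f (inverse x)) = (\<Sum>x\<in>-{0}. f x)"
  by (rule sum.reindex_bij_witness[of _ inverse inverse]) auto

lemma sum_UNIV_remove:
  fixes f :: "'a::finite \<Rightarrow> int"
  shows "(\<Sum>x\<in>UNIV. f x) = f a + (\<Sum>x\<in>-{a}. f x)"
  by (simp add: sum.remove[of UNIV a] Compl_eq_Diff_UNIV)

subsection \<open>The quadratic character\<close>

locale field_1_mod_4 =
  fixes q :: nat and type :: "'a::{finite,field} itself"
  assumes card_eq: "q = card (UNIV :: 'a set)"
    and q_mod_4: "q mod 4 = 1"
begin

text \<open>Euler's criterion serves as the definition, so multiplicativity comes from power laws;
  the link with square roots is \<open>card_square_roots\<close>.\<close>

definition chi :: "'a \<Rightarrow> int" where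
  "chi x = (if x = 0 then 0 else if x ^ ((q - 1) div 2) = 1 then 1 else - 1)"

lemma q_gt_1: "q > 1"
proof -
  have "card {0, 1 :: 'a} \<le> q"
    unfolding card_eq by (intro card_mono) auto
  then show ?thesis by simp
qed

lemma half_power_square:
  fixes x :: 'a
  assumes "x \<noteq> 0"
  shows "(x\<^sup>2) ^ ((q - 1) div 2) = 1"
proof -
  have "2 * ((q - 1) div 2) = q - 1"
    using q_mod_4 by presburger
  then show ?thesis
    using power_card_minus_one[OF assms] by (simp add: card_eq flip: power_mult)
qed

lemma half_power_cases:
  fixes x :: 'a
  assumes "x \<noteq> 0"
  shows "x ^ ((q - 1) div 2) = 1 \<or> x ^ ((q - 1) div 2) = - 1"
  using half_power_square[OF assms] by (simp add: power_commutes power2_eq_1_iff flip: power_mult)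
   (metis mult.commute power2_eq_1_iff power_mult)

text \<open>In characteristic 2, where -1 = 1, all \<open>q - 1\<close> nonzero elements would be
  roots of a polynomial of half that degree.\<close>

lemma two_neq_0: "(2 :: 'a) \<noteq> 0"
proof
  assume two: "(2 :: 'a) = 0"
  have "x ^ ((q - 1) div 2) = 1" if "x \<noteq> 0" for x :: 'a
  proof -
    have "(1 :: 'a) + 1 = 0"
      using two by simp
    then have "- 1 = (1 :: 'a)"
      by (simp add: add_eq_0_iff)
    with half_power_cases[OF that] show ?thesis by simp
  qed
  then have "- {0} \<subseteq> {x :: 'a. x ^ ((q - 1) div 2) = 1}"
    by auto
  then have "card (- {0 :: 'a}) \<le> card {x :: 'a. x ^ ((q - 1) div 2) = 1}"
    by (intro card_mono) auto
  also have "\<dots> \<le> (q - 1) div 2"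
    using q_gt_1 q_mod_4 by (intro card_power_eq_le) presburger
  finally show False
    using q_gt_1 by (simp add: Compl_eq_Diff_UNIV flip: card_eq)
qed

lemma neg_1_neq_1: "(- 1 :: 'a) \<noteq> 1"
proof
  assume "(- 1 :: 'a) = 1"
  then have "(1 :: 'a) + 1 = 0"
    by (metis add.right_inverse)
  then show False
    using two_neq_0 by simp
qed

lemma chi_0 [simp]: "chi 0 = 0"
  and chi_1 [simp]: "chi 1 = 1"
  by (simp_all add: chi_def)

lemma chi_eq_0_iff [simp]: "chi x = 0 \<longleftrightarrow> x = 0"
  by (simp add: chi_def)

lemma chi_mult: "chi (x * y) = chi x * chi y"
proof (cases "x = 0 \<or> y = 0")
  case False
  then have "x \<noteq> 0" "y \<noteq> 0" by simp_all
  from half_power_cases[OF this(1)] half_power_cases[OF this(2)] False neg_1_neq_1 show ?thesis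
    by (elim disjE) (simp_all add: chi_def power_mult_distrib)
qed (auto simp: chi_def)

lemma chi_power: "chi (x ^ k) = chi x ^ k"
  by (induction k) (simp_all add: chi_mult)

lemma chi_cases: "x \<noteq> 0 \<Longrightarrow> chi x = 1 \<or> chi x = - 1"
  by (simp add: chi_def)

lemma chi_square: "(chi x)\<^sup>2 = (if x = 0 then 0 else 1)"
  using chi_cases[of x] by auto

lemma chi_fourth_power: "x \<noteq> 0 \<Longrightarrow> chi x ^ 4 = 1"
  using chi_cases[of x] by auto

lemma chi_mult_self: "chi x * chi x = (if x = 0 then 0 else 1)"
  using chi_square by (simp add: power2_eq_square)

lemma chi_inverse: "chi (inverse x) = chi x"
proof (cases "x = 0")
  case False
  then have "chi (inverse x) * chi x = 1"
    by (simp flip: chi_mult)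
  then show ?thesis
    using chi_cases[OF False] by auto
qed simp

lemma chi_neg_1: "chi (- 1) = 1"
proof -
  have "even ((q - 1) div 2)"
    using q_mod_4 by presburger
  then show ?thesis
    by (simp add: chi_def)
qed

lemma chi_minus: "chi (- x) = chi x"
  using chi_mult[of "- 1" x] chi_neg_1 by simp

lemma chi_minus_commute: "chi (x - y) = chi (y - x)"
  using chi_minus[of "x - y"] by simp

text \<open>The easy half of Euler's criterion: a nonzero square has character 1 and at most two
  roots. Counting upgrades this to an equality in \<open>card_square_roots\<close>.\<close>

lemma card_square_roots_le: "int (card {y. y\<^sup>2 = p}) \<le> 1 + chi p"
proof (cases "p = 0")
  case False
  show ?thesis
  proof (cases "\<exists>y. y\<^sup>2 = p")
    case True
    then obtain y where "y\<^sup>2 = p" ..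
    then have "chi p = 1"
      using half_power_square[of y] False by (auto simp: chi_def)
    moreover have "card {y. y\<^sup>2 = p} \<le> 2"
      by (rule card_power_eq_le) simp
    ultimately show ?thesis by simp
  next
    case none: False
    show ?thesis
      using none chi_cases[OF False] by auto
  qed
qed simp

lemma sum_card_square_roots: "(\<Sum>p\<in>UNIV. int (card {y :: 'a. y\<^sup>2 = p})) = int q"
  using sum_fun_comp[of UNIV UNIV "\<lambda>y :: 'a. y\<^sup>2" "\<lambda>_. 1 :: int"] by (simp add: card_eq)

text \<open>At most half of the nonzero elements have character 1, which bounds the sum above.
  Conversely the numbers of square roots add up to \<open>q\<close>, and each is at most
  \<open>1 + chi p\<close>.\<close>

lemma sum_chi: "(\<Sum>x\<in>UNIV. chi x) = 0"
proof (rule antisym)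
  define m where "m = (q - 1) div 2"
  define A where "A = {x :: 'a. x ^ m = 1}"
  have m: "q = 2 * m + 1" "m > 0"
    using q_gt_1 q_mod_4 unfolding m_def by presburger+
  have "card A \<le> m"
    unfolding A_def by (rule card_power_eq_le) (rule m)
  have "0 \<notin> A"
    using m by (simp add: A_def zero_power)
  have "(\<Sum>x\<in>UNIV. chi x) = (\<Sum>x\<in>-{0}. chi x)"
    by (simp add: sum_UNIV_remove[of _ 0])
  also have "\<dots> = (\<Sum>x\<in>-{0}. 2 * (if x \<in> A then 1 else 0) - 1)"
    by (intro sum.cong) (auto simp: chi_def A_def m_def)
  also have "\<dots> = 2 * (\<Sum>x\<in>-{0}. if x \<in> A then 1 else 0) - (int q - 1)"
    using q_gt_1
    by (simp add: sum_subtractf sum_distrib_left Compl_eq_Diff_UNIV of_nat_diff flip: card_eq)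
  also have "(\<Sum>x\<in>-{0}. if x \<in> A then 1 else 0) = int (card A)"
    using \<open>0 \<notin> A\<close> by (simp add: sum.If_cases Int_absorb1)
  finally show "(\<Sum>x\<in>UNIV. chi x) \<le> 0"
    using \<open>card A \<le> m\<close> m by simp
next
  have "int q \<le> (\<Sum>p\<in>UNIV. 1 + chi p)"
    unfolding sum_card_square_roots[symmetric] by (intro sum_mono card_square_roots_le)
  then show "0 \<le> (\<Sum>x\<in>UNIV. chi x)"
    by (simp add: sum.distrib flip: card_eq)
qed

text \<open>The deficits in \<open>card_square_roots_le\<close> are nonnegative and add up to 0, so
  each vanishes; no primitive root is involved.\<close>

lemma card_square_roots: "int (card {y. y\<^sup>2 = p}) = 1 + chi p"
proof -
  have "(\<Sum>p\<in>UNIV. 1 + chi p - int (card {y. y\<^sup>2 = p})) = 0"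
    unfolding sum_subtractf sum_card_square_roots by (simp add: sum.distrib sum_chi flip: card_eq)
  moreover have "0 \<le> 1 + chi p - int (card {y. y\<^sup>2 = p})" for p
    using card_square_roots_le[of p] by simp
  ultimately have "1 + chi p - int (card {y. y\<^sup>2 = p}) = 0"
    by (subst (asm) sum_nonneg_eq_0_iff) auto
  then show ?thesis by simp
qed

lemma sum_squares: "(\<Sum>y\<in>UNIV. f (y\<^sup>2)) = (\<Sum>p\<in>UNIV. (1 + chi p) * f p)"
  for f :: "'a \<Rightarrow> int"
  using sum_fun_comp[of UNIV UNIV "\<lambda>y :: 'a. y\<^sup>2" f] by (simp add: card_square_roots)

section \<open>Complete sums of linear and quadratic polynomials\<close>

lemma sum_chi_linear:
  assumes "a \<noteq> 0"
  shows "(\<Sum>x\<in>UNIV. chi (a * x - b)) = 0"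
  using sum_affine[OF assms, of chi "- b"] by (simp add: sum_chi)

text \<open>For nonzero \<open>c\<close>, dividing by the square of \<open>x\<close> leaves a linear
  polynomial in \<open>inverse x\<close>. Its complete sum is 0, and the missing value at 0 accounts
  for the -1.\<close>

lemma sum_chi_quadratic_monic:
  "(\<Sum>x\<in>UNIV. chi (x * (x - c))) = (if c = 0 then int q else 0) - 1"
proof (cases "c = 0")
  case True
  have "(\<Sum>x\<in>UNIV. chi (x * x)) = (\<Sum>x\<in>-{0 :: 'a}. 1)"
    by (subst sum_UNIV_remove[of _ 0]) (simp add: chi_mult chi_mult_self)
  with True show ?thesis
    using q_gt_1 by (simp add: Compl_eq_Diff_UNIV of_nat_diff flip: card_eq)
next
  case False
  have "(\<Sum>x\<in>UNIV. chi (x * (x - c))) = (\<Sum>x\<in>-{0}. chi (x * (x - c)))"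
    by (simp add: sum_UNIV_remove[of _ 0])
  also have "\<dots> = (\<Sum>x\<in>-{0}. chi (c * inverse x - 1))"
  proof (rule sum.cong)
    fix x :: 'a assume "x \<in> - {0}"
    then have "c * inverse x - 1 = - (inverse x * (x - c))"
      by (simp add: field_simps)
    then show "chi (x * (x - c)) = chi (c * inverse x - 1)"
      by (simp add: chi_minus chi_mult chi_inverse del: minus_diff_eq)
  qed simp
  also have "\<dots> = (\<Sum>x\<in>-{0}. chi (c * x - 1))"
    by (rule sum_inverse)
  also have "\<dots> = - 1"
    using sum_chi_linear[OF False, of 1] by (simp add: sum_UNIV_remove[of _ 0] chi_neg_1)
  finally show ?thesis
    using False by simp
qed

lemma sum_chi_quadratic:
  assumes "a \<noteq> 0" "c \<noteq> 0"
  shows "(\<Sum>x\<in>UNIV. chi ((a * x - b) * (c * x - d)))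
    = chi (a * c) * ((if a * d = b * c then int q else 0) - 1)"
proof -
  have "(\<Sum>x\<in>UNIV. chi ((a * x - b) * (c * x - d)))
    = (\<Sum>x\<in>UNIV. chi ((a * (x + b / a) - b) * (c * (x + b / a) - d)))"
    using sum_affine[of 1 "\<lambda>x. chi ((a * x - b) * (c * x - d))" "b / a"] by simp
  also have "\<dots> = (\<Sum>x\<in>UNIV. chi (a * c) * chi (x * (x - (d / c - b / a))))"
  proof (rule sum.cong)
    fix x
    have "(a * (x + b / a) - b) * (c * (x + b / a) - d) = a * c * (x * (x - (d / c - b / a)))"
      using assms by (simp add: field_simps)
    then show "chi ((a * (x + b / a) - b) * (c * (x + b / a) - d))
        = chi (a * c) * chi (x * (x - (d / c - b / a)))"
      by (simp only: chi_mult)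
  qed simp
  also have "\<dots> = chi (a * c) * ((if d / c - b / a = 0 then int q else 0) - 1)"
    by (simp only: sum_chi_quadratic_monic flip: sum_distrib_left)
  also have "d / c - b / a = 0 \<longleftrightarrow> a * d = b * c"
    using assms by (auto simp: field_simps)
  finally show ?thesis .
qed

subsection \<open>Second moments\<close>

text \<open>For even \<open>k\<close> the sum with \<open>c = d ^ k\<close> in place of \<open>1\<close> has the same square, so
  at least \<open>(q - 1) / k\<close> members of the family indexed by \<open>c\<close> contribute equally to its second moment.\<close>

lemma twisted_sum_square_le:
  assumes "k > 0" "even k"
  shows "(\<Sum>x\<in>UNIV. chi (x * (x ^ k - 1)))\<^sup>2 \<le> int k ^ 2 * int q"
proof -
  define V where "V c = (\<Sum>x\<in>UNIV. chi (x * (x ^ k - c)))" for c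
  \<comment> \<open>Rescaling \<open>x\<close> by \<open>d\<close> pulls out
    \<open>d ^ Suc k\<close>, whose sign disappears on squaring.\<close>
  have V_scale: "(V (d ^ k))\<^sup>2 = (V 1)\<^sup>2" if "d \<noteq> 0" for d
  proof -
    have "V (d ^ k) = (\<Sum>x\<in>UNIV. chi (d * x * ((d * x) ^ k - d ^ k)))"
      unfolding V_def using sum_affine[OF that, of "\<lambda>x. chi (x * (x ^ k - d ^ k))" 0] by simp
    also have "\<dots> = (\<Sum>x\<in>UNIV. chi (d ^ Suc k) * chi (x * (x ^ k - 1)))"
      by (intro sum.cong) (simp_all add: algebra_simps flip: chi_mult)
    also have "\<dots> = chi (d ^ Suc k) * V 1"
      by (simp only: V_def sum_distrib_left)
    finally show ?thesis
      using that by (simp add: power_mult_distrib chi_square del: power_Suc)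
  qed
  have corr: "(\<Sum>c\<in>UNIV. chi (x ^ k - c) * chi (y ^ k - c)) = (if x ^ k = y ^ k then int q else 0) - 1"
    for x y
    using sum_chi_quadratic[of 1 1 "x ^ k" "y ^ k"]
    by (simp add: chi_mult chi_minus_commute[of "_ ^ k"] eq_commute)
  have "(\<Sum>c\<in>UNIV. (V c)\<^sup>2) = (\<Sum>c\<in>UNIV. \<Sum>x\<in>UNIV. \<Sum>y\<in>UNIV.
      (chi x * chi y) * (chi (x ^ k - c) * chi (y ^ k - c)))"
    by (simp add: V_def power2_eq_square sum_product chi_mult mult_ac)
  also have "\<dots> = (\<Sum>x\<in>UNIV. \<Sum>y\<in>UNIV. \<Sum>c\<in>UNIV.
      (chi x * chi y) * (chi (x ^ k - c) * chi (y ^ k - c)))"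
    by (rule trans[OF sum.swap]) (intro sum.cong refl sum.swap)
  also have "\<dots> = (\<Sum>x\<in>UNIV. \<Sum>y\<in>UNIV.
      (chi x * chi y) * ((if x ^ k = y ^ k then int q else 0) - 1))"
    by (simp only: corr flip: sum_distrib_left)
  \<comment> \<open>The constant -1 of every correlation contributes the square of the complete sum
    of \<open>chi\<close>, which is 0.\<close>
  also have "\<dots> = (\<Sum>x\<in>UNIV. \<Sum>y\<in>UNIV. if x ^ k = y ^ k then int q * (chi x * chi y) else 0)
      - (\<Sum>x\<in>UNIV. chi x) * (\<Sum>y\<in>UNIV. chi y)"
    unfolding sum_product sum_subtractf[symmetric] by (intro sum.cong refl) (auto simp: algebra_simps)
  also have "\<dots> = (\<Sum>x\<in>UNIV. \<Sum>y\<in>UNIV. if x ^ k = y ^ k then int q * (chi x * chi y) else 0)"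
    by (simp add: sum_chi)
  also have "\<dots> = (\<Sum>x\<in>-{0}. \<Sum>y\<in>UNIV. if x ^ k = y ^ k then int q * (chi x * chi y) else 0)"
    by (simp add: sum_UNIV_remove[of _ 0] cong: if_cong)
  also have "\<dots> \<le> (\<Sum>x\<in>-{0 :: 'a}. int k * int q)"
  proof (rule sum_mono)
    fix x :: 'a
    have le_q: "int q * (chi x * chi y) \<le> int q" for y
      using chi_cases[of x] chi_cases[of y] by (cases "x = 0"; cases "y = 0") auto
    have "(\<Sum>y\<in>UNIV. if x ^ k = y ^ k then int q * (chi x * chi y) else 0)
        \<le> (\<Sum>y\<in>UNIV. if x ^ k = y ^ k then int q else 0)"
      by (intro sum_mono) (simp add: le_q)
    also have "\<dots> = int (card {y. y ^ k = x ^ k}) * int q"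
      by (simp add: sum.If_cases eq_commute)
    also have "\<dots> \<le> int k * int q"
      using card_power_eq_le[OF assms(1), of "x ^ k"] by (intro mult_right_mono) auto
    finally show "(\<Sum>y\<in>UNIV. if x ^ k = y ^ k then int q * (chi x * chi y) else 0) \<le> int k * int q" .
  qed
  also have "\<dots> = (int q - 1) * (int k * int q)"
    using q_gt_1 by (simp add: Compl_eq_Diff_UNIV of_nat_diff flip: card_eq)
  finally have moment: "(\<Sum>c\<in>UNIV. (V c)\<^sup>2) \<le> (int q - 1) * (int k * int q)" .
  have "(int q - 1) * (V 1)\<^sup>2 = (\<Sum>d\<in>-{0}. (V (d ^ k))\<^sup>2)"
    using q_gt_1 by (simp add: V_scale Compl_eq_Diff_UNIV of_nat_diff flip: card_eq)
  also have "\<dots> \<le> int k * (\<Sum>c\<in>UNIV. (V c)\<^sup>2)"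
  proof (rule sum_comp_le)
    show "card {d \<in> - {0}. d ^ k = c} \<le> k" for c :: 'a
      by (rule order.trans[OF card_mono card_power_eq_le[OF assms(1), of c]]) auto
  qed auto
  also have "\<dots> \<le> int k * ((int q - 1) * (int k * int q))"
    by (intro mult_left_mono moment) simp
  finally have "(int q - 1) * (V 1)\<^sup>2 \<le> (int q - 1) * (int k ^ 2 * int q)"
    by (simp add: power2_eq_square mult_ac)
  with q_gt_1 show ?thesis
    by (simp add: V_def)
qed

text \<open>Up to sign the Frobenius trace of the Legendre curve with parameter \<mu>. The
  degenerate parameters 0 and 1 are included, so the second moment runs over the whole
  field.\<close>

definition legendre_sum :: "'a \<Rightarrow> int" where
  "legendre_sum \<mu> = (\<Sum>z\<in>UNIV. chi (z * (z - 1) * (z - \<mu>)))"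

text \<open>The diagonal gives \<open>q\<close> for each of the \<open>q - 2\<close> elements other
  than 0 and 1; the constant -1 of the correlations gives minus the square of a quadratic sum equal
  to -1.\<close>

lemma sum_legendre_sum_square: "(\<Sum>\<mu>\<in>UNIV. (legendre_sum \<mu>)\<^sup>2) = int q * (int q - 2) - 1"
proof -
  have corr: "(\<Sum>\<mu>\<in>UNIV. chi (x - \<mu>) * chi (y - \<mu>)) = (if x = y then int q else 0) - 1" for x y
    using sum_chi_quadratic[of 1 1 x y]
    by (simp add: chi_mult chi_minus_commute[of x] chi_minus_commute[of y] eq_commute)
  have "(\<Sum>\<mu>\<in>UNIV. (legendre_sum \<mu>)\<^sup>2) = (\<Sum>\<mu>\<in>UNIV. \<Sum>x\<in>UNIV. \<Sum>y\<in>UNIV.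
      (chi (x * (x - 1)) * chi (y * (y - 1))) * (chi (x - \<mu>) * chi (y - \<mu>)))"
    by (simp add: legendre_sum_def power2_eq_square sum_product chi_mult mult_ac)
  also have "\<dots> = (\<Sum>x\<in>UNIV. \<Sum>y\<in>UNIV. \<Sum>\<mu>\<in>UNIV.
      (chi (x * (x - 1)) * chi (y * (y - 1))) * (chi (x - \<mu>) * chi (y - \<mu>)))"
    by (rule trans[OF sum.swap]) (intro sum.cong refl sum.swap)
  also have "\<dots> = (\<Sum>x\<in>UNIV. \<Sum>y\<in>UNIV.
      (chi (x * (x - 1)) * chi (y * (y - 1))) * ((if x = y then int q else 0) - 1))"
    by (simp only: corr flip: sum_distrib_left)
  also have "\<dots> = (\<Sum>x\<in>UNIV. \<Sum>y\<in>UNIV.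
        if x = y then int q * (chi (x * (x - 1)) * chi (y * (y - 1))) else 0)
      - (\<Sum>x\<in>UNIV. chi (x * (x - 1))) * (\<Sum>y\<in>UNIV. chi (y * (y - 1)))"
    unfolding sum_product sum_subtractf[symmetric] by (intro sum.cong refl) (auto simp: algebra_simps)
  also have "\<dots> = int q * (\<Sum>x\<in>UNIV. (chi (x * (x - 1)))\<^sup>2) - 1"
    by (simp add: sum_chi_quadratic_monic power2_eq_square flip: sum_distrib_left)
  also have "(\<Sum>x\<in>UNIV. (chi (x * (x - 1)))\<^sup>2) = (\<Sum>x\<in>UNIV. if x \<in> {0, 1 :: 'a} then 0 else 1)"
    by (intro sum.cong) (auto simp: chi_square)
  also have "\<dots> = int (card (- {0, 1 :: 'a}))"
    by (subst sum.If_cases) (auto intro!: arg_cong[of _ _ card])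
  also have "\<dots> = int q - 2"
    using q_gt_1
    by (simp add: sum.If_cases Compl_eq_Diff_UNIV card_Diff_subset of_nat_diff
        flip: card_eq)
  finally show ?thesis .
qed

subsection \<open>Cubic sums\<close>

text \<open>Besides \<open>x = h + k\<close>, \<open>y = h - k\<close> and \<open>P = k\<^sup>2\<close>, the proof substitutes \<open>P = h\<^sup>2 - 1 / w\<close>, which
  moves one root of the quartic in \<open>P\<close> to infinity. The term \<open>int q\<close> produced by the summand \<open>1\<close> of
  \<open>1 + chi P\<close> then cancels against the \<open>- 1\<close> contributed by \<open>w = 0\<close> for each \<open>h\<close>.\<close>

lemma cubic_sum_square_eq:
  fixes e1 e2 :: 'a
  assumes "e1 \<noteq> 0" "e2 \<noteq> 0" "e1 \<noteq> e2"
  shows "(\<Sum>x\<in>UNIV. chi (x * (x - e1) * (x - e2)))\<^sup>2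
    = (\<Sum>h\<in>UNIV. \<Sum>w\<in>UNIV.
        chi ((h\<^sup>2 * w - 1) * ((2 * h * e1 - e1\<^sup>2) * w - 1) * ((2 * h * e2 - e2\<^sup>2) * w - 1)))"
proof -
  define f where "f x = x * (x - e1) * (x - e2)" for x
  define F where "F h P = chi ((h\<^sup>2 - P) * ((h - e1)\<^sup>2 - P) * ((h - e2)\<^sup>2 - P))" for h P
  define G where "G h w = chi ((h\<^sup>2 * w - 1) * ((2 * h * e1 - e1\<^sup>2) * w - 1) * ((2 * h * e2 - e2\<^sup>2) * w - 1))"
    for h w
  have "(\<Sum>x\<in>UNIV. chi (f x))\<^sup>2 = (\<Sum>(x, y)\<in>UNIV. chi (f x * f y))"
    by (simp add: power2_eq_square sum_product sum.cartesian_product chi_mult)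
  also have "\<dots> = (\<Sum>(h, k)\<in>UNIV. F h (k\<^sup>2))"
  proof (rule sum.reindex_bij_witness[symmetric])
    have halves: "(u + v) / 2 + (u - v) / 2 = u" "(u + v) / 2 - (u - v) / 2 = v"
      "(u + v + (u - v)) / 2 = u" "(u + v - (u - v)) / 2 = v" for u v :: 'a
      using two_neq_0 by (simp_all flip: add_divide_distrib diff_divide_distrib mult_2)
    show "(\<lambda>(x, y). ((x + y) / 2, (x - y) / 2)) ((\<lambda>(h, k). (h + k, h - k)) p) = p"
      "(\<lambda>(h, k). (h + k, h - k)) ((\<lambda>(x, y). ((x + y) / 2, (x - y) / 2)) p) = p" for p :: "'a \<times> 'a"
      by (simp_all add: case_prod_beta halves two_neq_0)
    have "f (h + k) * f (h - k) = (h\<^sup>2 - k\<^sup>2) * ((h - e1)\<^sup>2 - k\<^sup>2) * ((h - e2)\<^sup>2 - k\<^sup>2)" for h k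
      unfolding f_def by algebra
    then show "(\<lambda>(x, y). chi (f x * f y)) ((\<lambda>(h, k). (h + k, h - k)) p) = (\<lambda>(h, k). F h (k\<^sup>2)) p" for p
      by (simp add: F_def case_prod_beta)
  qed auto
  also have "\<dots> = (\<Sum>h\<in>UNIV. \<Sum>k\<in>UNIV. F h (k\<^sup>2))"
    by (simp add: sum.cartesian_product)
  also have "\<dots> = (\<Sum>h\<in>UNIV. \<Sum>P\<in>UNIV. (1 + chi P) * F h P)"
    by (simp add: sum_squares)
  also have "\<dots> = (\<Sum>h\<in>UNIV. \<Sum>P\<in>UNIV. F h P) + (\<Sum>h\<in>UNIV. \<Sum>P\<in>UNIV. chi P * F h P)"
    by (simp add: algebra_simps sum.distrib)
  also have "(\<Sum>h\<in>UNIV. \<Sum>P\<in>UNIV. F h P) = int q"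
  proof -
    \<comment> \<open>With \<open>P = h\<^sup>2 - p\<close> the other two factors become linear in
      \<open>h\<close>, so summing over \<open>h\<close> first leaves a quadratic sum.\<close>
    have "(\<Sum>P\<in>UNIV. F h P) = (\<Sum>p\<in>UNIV. F h (h\<^sup>2 - p))" for h
      using sum_affine[of "- 1" "F h" "h\<^sup>2"] by simp
    then have "(\<Sum>h\<in>UNIV. \<Sum>P\<in>UNIV. F h P) = (\<Sum>p\<in>UNIV. \<Sum>h\<in>UNIV. F h (h\<^sup>2 - p))"
      by (simp add: sum.swap[of "\<lambda>p h. F h (h\<^sup>2 - p)"])
    also have "\<dots> = (\<Sum>p\<in>UNIV. \<Sum>h\<in>UNIV.
        chi p * chi ((2 * e1 * h - (p + e1\<^sup>2)) * (2 * e2 * h - (p + e2\<^sup>2))))"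
      by (intro sum.cong) (simp_all add: F_def algebra_simps power2_eq_square flip: chi_mult)
    also have "\<dots> = (\<Sum>p\<in>UNIV. chi p * (chi (e1 * e2) * ((if p = e1 * e2 then int q else 0) - 1)))"
    proof (rule sum.cong)
      fix p
      \<comment> \<open>The two linear factors share their root only for \<open>p = e1 * e2\<close>;
        this single \<open>p\<close> yields \<open>int q\<close>, and the -1 terms cancel over all
        \<open>p\<close>.\<close>
      have "2 * e1 * (p + e2\<^sup>2) = (p + e1\<^sup>2) * (2 * e2) \<longleftrightarrow> 2 * ((e1 - e2) * (p - e1 * e2)) = 0"
        by (auto simp: algebra_simps power2_eq_square)
      also have "\<dots> \<longleftrightarrow> p = e1 * e2"
        using two_neq_0 assms by simp
      finally have iff: "2 * e1 * (p + e2\<^sup>2) = (p + e1\<^sup>2) * (2 * e2) \<longleftrightarrow> p = e1 * e2" .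
      have "chi (2 * e1 * (2 * e2)) = chi 2 * chi 2 * chi (e1 * e2)"
        by (simp only: chi_mult mult_ac)
      then have "chi (2 * e1 * (2 * e2)) = chi (e1 * e2)"
        using two_neq_0 by (simp add: chi_mult_self)
      then show "(\<Sum>h\<in>UNIV. chi p * chi ((2 * e1 * h - (p + e1\<^sup>2)) * (2 * e2 * h - (p + e2\<^sup>2))))
          = chi p * (chi (e1 * e2) * ((if p = e1 * e2 then int q else 0) - 1))"
        using two_neq_0 assms by (simp add: sum_chi_quadratic iff flip: sum_distrib_left)
    qed simp
    also have "\<dots> = (\<Sum>p\<in>UNIV.
        (if p = e1 * e2 then int q * (chi p * chi (e1 * e2)) else 0) - chi (e1 * e2) * chi p)"
      by (intro sum.cong) (auto simp: algebra_simps)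
    also have "\<dots> = int q"
      using assms by (simp add: sum_subtractf sum_chi chi_mult_self flip: sum_distrib_left)
    finally show ?thesis .
  qed
  also have "(\<Sum>h\<in>UNIV. \<Sum>P\<in>UNIV. chi P * F h P) = (\<Sum>h\<in>UNIV. (\<Sum>w\<in>UNIV. G h w) - 1)"
  proof (rule sum.cong)
    fix h :: 'a
    have "(\<Sum>P\<in>UNIV. chi P * F h P) = (\<Sum>p\<in>UNIV. chi (h\<^sup>2 - p) * F h (h\<^sup>2 - p))"
      using sum_affine[of "- 1" "\<lambda>P. chi P * F h P" "h\<^sup>2"] by simp
    also have "\<dots> = (\<Sum>p\<in>-{0}. chi (h\<^sup>2 - p) * F h (h\<^sup>2 - p))"
      by (simp add: sum_UNIV_remove[of _ 0] F_def)
    also have "\<dots> = (\<Sum>w\<in>-{0}. chi (h\<^sup>2 - inverse w) * F h (h\<^sup>2 - inverse w))"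
      by (rule sum_inverse[symmetric])
    also have "\<dots> = (\<Sum>w\<in>-{0}. G h w)"
    proof (rule sum.cong)
      fix w :: 'a assume "w \<in> - {0}"
      then have w: "w \<noteq> 0" by simp
      \<comment> \<open>Each of the four factors releases one \<open>inverse w\<close>, and their
        fourth power has character 1; the two sign changes cancel.\<close>
      have "(h\<^sup>2 - inverse w) * (inverse w * ((h - e1)\<^sup>2 - (h\<^sup>2 - inverse w)) * ((h - e2)\<^sup>2 - (h\<^sup>2 - inverse w)))
          = inverse w ^ 4 * ((h\<^sup>2 * w - 1) * ((2 * h * e1 - e1\<^sup>2) * w - 1) * ((2 * h * e2 - e2\<^sup>2) * w - 1))"
        using w by (simp add: field_simps eval_nat_numeral)
      moreover have "F h (h\<^sup>2 - inverse w)
          = chi (inverse w * ((h - e1)\<^sup>2 - (h\<^sup>2 - inverse w)) * ((h - e2)\<^sup>2 - (h\<^sup>2 - inverse w)))"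
        by (simp add: F_def)
      ultimately have "chi (h\<^sup>2 - inverse w) * F h (h\<^sup>2 - inverse w) = chi (inverse w) ^ 4 * G h w"
        by (simp only: G_def flip: chi_mult chi_power)
      then show "chi (h\<^sup>2 - inverse w) * F h (h\<^sup>2 - inverse w) = G h w"
        using w by (simp add: chi_fourth_power)
    qed simp
    also have "\<dots> = (\<Sum>w\<in>UNIV. G h w) - 1"
      by (simp add: sum_UNIV_remove[of _ 0] G_def chi_neg_1)
    finally show "(\<Sum>P\<in>UNIV. chi P * F h P) = (\<Sum>w\<in>UNIV. G h w) - 1" .
  qed simp
  also have "int q + \<dots> = (\<Sum>h\<in>UNIV. \<Sum>w\<in>UNIV. G h w)"
    by (simp add: sum_subtractf flip: card_eq)
  finally show ?thesis
    by (simp add: f_def G_def)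
qed

text \<open>The affine map sending \<open>0, 1\<close> to \<open>1 / a, 1 / c\<close> puts the cubic in Legendre form.\<close>

lemma fibre_sum_square:
  assumes "a \<noteq> 0" "b \<noteq> 0" "c \<noteq> 0" "a \<noteq> c"
  shows "(\<Sum>w\<in>UNIV. chi ((a * w - 1) * (b * w - 1) * (c * w - 1)))\<^sup>2
    = (legendre_sum (c * (a - b) / (b * (a - c))))\<^sup>2"
proof -
  define d where "d = 1 / c - 1 / a"
  define \<mu> where "\<mu> = c * (a - b) / (b * (a - c))"
  have "d \<noteq> 0"
    using assms by (simp add: d_def field_simps)
  have "(\<Sum>w\<in>UNIV. chi ((a * w - 1) * (b * w - 1) * (c * w - 1)))
    = (\<Sum>z\<in>UNIV. chi ((a * (d * z + 1 / a) - 1) * (b * (d * z + 1 / a) - 1) * (c * (d * z + 1 / a) - 1)))"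
    by (rule sum_affine[OF \<open>d \<noteq> 0\<close>, symmetric])
  also have "\<dots> = (\<Sum>z\<in>UNIV. chi (a * b * c * d ^ 3) * chi (z * (z - 1) * (z - \<mu>)))"
  proof (rule sum.cong)
    fix z
    have a: "a * (d * z + 1 / a) - 1 = a * d * z"
      using assms by (simp add: field_simps)
    have c: "c * (d * z + 1 / a) - 1 = c * d * (z - 1)"
      using assms by (simp add: field_simps d_def)
    \<comment> \<open>The affine map sends \<mu> to the third root \<open>1 / b\<close>, which may
      coincide with one of the others.\<close>
    have "d * \<mu> = 1 / b - 1 / a"
      using assms by (simp add: d_def \<mu>_def divide_simps)
    then have b: "b * (d * z + 1 / a) - 1 = b * d * (z - \<mu>)"
      using assms by (simp add: right_diff_distrib mult.assoc) (simp add: field_simps)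
    show "chi ((a * (d * z + 1 / a) - 1) * (b * (d * z + 1 / a) - 1) * (c * (d * z + 1 / a) - 1))
        = chi (a * b * c * d ^ 3) * chi (z * (z - 1) * (z - \<mu>))"
      unfolding a b c by (simp add: power3_eq_cube mult_ac flip: chi_mult)
  qed simp
  also have "\<dots> = chi (a * b * c * d ^ 3) * legendre_sum \<mu>"
    by (simp only: legendre_sum_def sum_distrib_left)
  finally show ?thesis
    using assms \<open>d \<noteq> 0\<close> by (simp add: power_mult_distrib chi_square \<mu>_def)
qed

text \<open>Cauchy-Schwarz over \<open>h\<close> costs a factor \<open>q\<close>. The regular
  \<open>h\<close> contribute at most three Legendre second moments, the exceptional ones at most
  \<open>3 * q\<^sup>2 + 1\<close>, which makes \<open>6 * q\<^sup>2\<close> in total.\<close>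

lemma cubic_sum_bound_aux:
  fixes e1 e2 :: 'a
  assumes "e1 \<noteq> 0" "e2 \<noteq> 0" "e1 \<noteq> e2"
  shows "(\<Sum>x\<in>UNIV. chi (x * (x - e1) * (x - e2))) ^ 4 \<le> 6 * int q ^ 3"
proof -
  define H where "H h = (\<Sum>w\<in>UNIV.
      chi ((h\<^sup>2 * w - 1) * ((2 * h * e1 - e1\<^sup>2) * w - 1) * ((2 * h * e2 - e2\<^sup>2) * w - 1)))" for h
  define \<mu> where "\<mu> h = (2 * h * e2 - e2\<^sup>2) * (h\<^sup>2 - (2 * h * e1 - e1\<^sup>2))
      / ((2 * h * e1 - e1\<^sup>2) * (h\<^sup>2 - (2 * h * e2 - e2\<^sup>2)))" for h
  \<comment> \<open>For \<open>h \<in> B\<close> the cubic in \<open>w\<close> is degenerate. The trivial bound for all four elements would only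
    give the constant 7, which is too large for the theorem, hence the extra care for \<open>h = e2\<close>.\<close>
  define E where "E = {0, e1 / 2, e2 / 2}"
  define B where "B = insert e2 E"
  have e1_half: "2 * h * e1 - e1\<^sup>2 = 0 \<longleftrightarrow> h = e1 / 2" for h
    using assms two_neq_0 by (auto simp: field_simps power2_eq_square)
  have e2_half: "2 * h * e2 - e2\<^sup>2 = 0 \<longleftrightarrow> h = e2 / 2" for h
    using assms two_neq_0 by (auto simp: field_simps power2_eq_square)
  have diff_sq: "h\<^sup>2 - (2 * h * e - e\<^sup>2) = (h - e)\<^sup>2" for h e :: 'a
    by (simp add: algebra_simps power2_eq_square)
  have H_le: "(H h)\<^sup>2 \<le> (int q)\<^sup>2" for h
  proof -
    have "\<bar>H h\<bar> \<le> (\<Sum>w\<in>(UNIV :: 'a set). 1)"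
      unfolding H_def by (rule order.trans[OF sum_abs], rule sum_mono) (simp add: chi_def)
    then show ?thesis
      by (simp add: power2_le_iff_abs_le flip: card_eq)
  qed
  have "(\<Sum>h\<in>-B. (H h)\<^sup>2) = (\<Sum>h\<in>-B. (legendre_sum (\<mu> h))\<^sup>2)"
  proof (rule sum.cong)
    fix h assume "h \<in> - B"
    then have "h\<^sup>2 \<noteq> 0" "2 * h * e1 - e1\<^sup>2 \<noteq> 0" "2 * h * e2 - e2\<^sup>2 \<noteq> 0" "h\<^sup>2 \<noteq> 2 * h * e2 - e2\<^sup>2"
      using diff_sq[of h e2] unfolding e1_half e2_half by (auto simp: B_def E_def)
    then show "(H h)\<^sup>2 = (legendre_sum (\<mu> h))\<^sup>2"
      unfolding H_def \<mu>_def by (rule fibre_sum_square)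
  qed simp
  also have "\<dots> \<le> int 3 * (\<Sum>\<mu>\<in>UNIV. (legendre_sum \<mu>)\<^sup>2)"
  proof (rule sum_comp_le)
    fix t :: 'a
    let ?p = "[:- e2, 1:]\<^sup>2 * [:- (e1\<^sup>2), 2 * e1:]"
    let ?r = "[:- e1, 1:]\<^sup>2 * [:- (e2\<^sup>2), 2 * e2:]"
    define g where "g = ?r - smult t ?p"
    have deg: "degree ([:u, 1:]\<^sup>2 * [:v, w:]) \<le> 3" for u v w :: 'a
      by (rule order.trans[OF degree_mult_le]) (simp add: degree_linear_power)
    have "degree g \<le> 3"
      unfolding g_def by (intro degree_diff_le deg order.trans[OF degree_smult_le])
    \<comment> \<open>The roots of \<open>g\<close> include the fibre of \<mu> over
      \<open>t\<close>. The value at \<open>e1\<close> shows \<open>g \<noteq> 0\<close> unless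
      \<open>t = 0\<close>, where the value at 0 does.\<close>
    have "poly g e1 = - (t * e1\<^sup>2 * (e1 - e2)\<^sup>2)"
      by (simp add: g_def power2_eq_square algebra_simps)
    moreover have "poly g 0 = - (e1\<^sup>2 * e2\<^sup>2)" if "t = 0"
      using that by (simp add: g_def power2_eq_square)
    ultimately have "g \<noteq> 0"
      using assms by (cases "t = 0") auto
    have "{h \<in> - B. \<mu> h = t} \<subseteq> {h. poly g h = 0}"
    proof safe
      fix h assume h: "h \<notin> B" "t = \<mu> h"
      then have "2 * h * e1 - e1\<^sup>2 \<noteq> 0" "(h - e2)\<^sup>2 \<noteq> 0"
        unfolding e1_half by (auto simp: B_def E_def)
      then have "\<mu> h * ((2 * h * e1 - e1\<^sup>2) * (h - e2)\<^sup>2) = (2 * h * e2 - e2\<^sup>2) * (h - e1)\<^sup>2"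
        by (simp add: \<mu>_def diff_sq)
      then show "poly g h = 0"
        by (simp add: g_def h power2_eq_square algebra_simps)
    qed
    then have "card {h \<in> - B. \<mu> h = t} \<le> card {h. poly g h = 0}"
      by (intro card_mono) auto
    also have "\<dots> \<le> 3"
      using card_poly_roots_bound[OF \<open>g \<noteq> 0\<close>] \<open>degree g \<le> 3\<close> by linarith
    finally show "card {h \<in> - B. \<mu> h = t} \<le> 3" .
  qed auto
  finally have good: "(\<Sum>h\<in>-B. (H h)\<^sup>2) \<le> 3 * (int q * (int q - 2) - 1)"
    by (simp add: sum_legendre_sum_square)
  have "card E \<le> 3"
    by (simp add: E_def card_insert_if)
  have "(\<Sum>h\<in>E. (H h)\<^sup>2) \<le> int (card E) * (int q)\<^sup>2"
    using sum_bounded_above[of E "\<lambda>h. (H h)\<^sup>2" "(int q)\<^sup>2"] H_le by simp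
  also have "\<dots> \<le> 3 * (int q)\<^sup>2"
    using \<open>card E \<le> 3\<close> by (intro mult_right_mono) auto
  finally have E_le: "(\<Sum>h\<in>E. (H h)\<^sup>2) \<le> 3 * (int q)\<^sup>2" .
  \<comment> \<open>At \<open>h = e2\<close> two factors coincide. Outside \<open>E\<close> this
    leaves a linear sum without the term at \<open>1 / e2\<^sup>2\<close>, hence minus a single
    character value.\<close>
  have "(\<Sum>h\<in>B. (H h)\<^sup>2) \<le> 3 * (int q)\<^sup>2 + 1"
  proof (cases "e2 \<in> E")
    case True
    with E_le show ?thesis
      by (simp add: B_def insert_absorb)
  next
    case False
    define b where "b = 2 * e2 * e1 - e1\<^sup>2"
    have "b \<noteq> 0"
      using False e1_half[of e2] by (simp add: b_def E_def)
    have eq: "2 * e2 * e2 - e2\<^sup>2 = e2\<^sup>2"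
      by (simp add: power2_eq_square)
    have "H e2 = (\<Sum>w\<in>UNIV. chi (b * w - 1) * (chi (e2\<^sup>2 * w - 1))\<^sup>2)"
      unfolding H_def b_def eq by (simp only: chi_mult power2_eq_square[of "chi _"] mult_ac)
    also have "\<dots> = (\<Sum>w\<in>-{1 / e2\<^sup>2}. chi (b * w - 1))"
      using assms by (subst sum_UNIV_remove[of _ "1 / e2\<^sup>2"]) (auto intro!: sum.cong simp: chi_square field_simps)
    also have "\<dots> = - chi (b * (1 / e2\<^sup>2) - 1)"
      using sum_chi_linear[OF \<open>b \<noteq> 0\<close>, of 1] by (subst (asm) sum_UNIV_remove[of _ "1 / e2\<^sup>2"]) simp
    finally have "(H e2)\<^sup>2 \<le> 1"
      by (simp add: chi_square)
    then show ?thesis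
      using E_le False by (simp add: B_def E_def)
  qed
  moreover have "(\<Sum>h\<in>UNIV. (H h)\<^sup>2) = (\<Sum>h\<in>B. (H h)\<^sup>2) + (\<Sum>h\<in>-B. (H h)\<^sup>2)"
    by (subst sum.union_disjoint[symmetric]) auto
  ultimately have "(\<Sum>h\<in>UNIV. (H h)\<^sup>2) \<le> 6 * (int q)\<^sup>2"
    using good q_gt_1 by (simp add: power2_eq_square algebra_simps)
  have "(\<Sum>x\<in>UNIV. chi (x * (x - e1) * (x - e2))) ^ 4 = (\<Sum>h\<in>UNIV. H h)\<^sup>2"
    unfolding H_def cubic_sum_square_eq[OF assms, symmetric] by (simp flip: power_mult)
  also have "\<dots> \<le> int q * (\<Sum>h\<in>UNIV. (H h)\<^sup>2)"
    using sum_squared_le_card_sum_squares[of UNIV H] by (simp flip: card_eq)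
  also have "\<dots> \<le> int q * (6 * (int q)\<^sup>2)"
    by (rule mult_left_mono) (fact, simp)
  finally show ?thesis
    by (simp add: power2_eq_square power3_eq_cube mult_ac)
qed

lemma cubic_sum_bound:
  assumes "a \<noteq> b" "a \<noteq> c" "b \<noteq> c"
  shows "(\<Sum>x\<in>UNIV. chi ((x - a) * (x - b) * (x - c))) ^ 4 \<le> 6 * int q ^ 3"
proof -
  have "(\<Sum>x\<in>UNIV. chi ((x - a) * (x - b) * (x - c)))
      = (\<Sum>x\<in>UNIV. chi (x * (x - (b - a)) * (x - (c - a))))"
    using sum_affine[of 1 "\<lambda>x. chi ((x - a) * (x - b) * (x - c))" a] by (simp add: algebra_simps)
  then show ?thesis
    using cubic_sum_bound_aux[of "b - a" "c - a"] assms by simp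
qed

subsection \<open>Expansion of the product\<close>

lemma exists_square_root_minus_one: "\<exists>z :: 'a. z\<^sup>2 = - 1"
proof (rule ccontr)
  assume "\<not> ?thesis"
  then have "card {z :: 'a. z\<^sup>2 = - 1} = 0" by simp
  then show False
    using card_square_roots[of "- 1"] by (simp add: chi_neg_1)
qed

lemma chi_half_power: "y ^ (1 + (q - 1) div 2) = y \<Longrightarrow> y \<noteq> 0 \<Longrightarrow> chi y = 1"
  by (simp add: chi_def)

text \<open>Squares \<open>u\<close> are counted with weight \<open>1 + chi u\<close>; the weight 1
  gives a quadratic sum with distinct roots, that is -1.\<close>

lemma sum_chi_fourth_power: "(\<Sum>x\<in>UNIV. chi (x ^ 4 - 1)) = (\<Sum>x\<in>UNIV. chi (x * (x\<^sup>2 - 1))) - 1"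
proof -
  have "(\<Sum>x\<in>UNIV. chi (x ^ 4 - 1)) = (\<Sum>x\<in>UNIV. chi ((x\<^sup>2)\<^sup>2 - 1))"
    by (simp flip: power_mult)
  also have "\<dots> = (\<Sum>u\<in>UNIV. (1 + chi u) * chi (u\<^sup>2 - 1))"
    by (rule sum_squares)
  also have "\<dots> = (\<Sum>u\<in>UNIV. chi (u\<^sup>2 - 1)) + (\<Sum>x\<in>UNIV. chi (x * (x\<^sup>2 - 1)))"
    by (simp only: chi_mult distrib_right sum.distrib mult_1)
  also have "(\<Sum>u\<in>UNIV. chi (u\<^sup>2 - 1)) = - 1"
    using sum_chi_quadratic[of 1 1 1 "- 1"] neg_1_neq_1 by (simp add: power2_eq_square algebra_simps)
  finally show ?thesis by simp
qed

lemma cubic_sum_scale: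
  assumes "t \<noteq> 0"
  shows "(\<Sum>x\<in>UNIV. chi ((x - t * a) * (x - t * b) * (x - t * c)))
    = chi t * (\<Sum>x\<in>UNIV. chi ((x - a) * (x - b) * (x - c)))"
proof -
  have "(\<Sum>x\<in>UNIV. chi ((x - t * a) * (x - t * b) * (x - t * c)))
      = (\<Sum>x\<in>UNIV. chi ((t * x - t * a) * (t * x - t * b) * (t * x - t * c)))"
    using sum_affine[OF assms, of "\<lambda>x. chi ((x - t * a) * (x - t * b) * (x - t * c))" 0] by simp
  also have "\<dots> = (\<Sum>x\<in>UNIV. chi t * chi ((x - a) * (x - b) * (x - c)))"
  proof (rule sum.cong)
    fix x
    have "(t * x - t * a) * (t * x - t * b) * (t * x - t * c) = t\<^sup>2 * (t * ((x - a) * (x - b) * (x - c)))"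
      by algebra
    then show "chi ((t * x - t * a) * (t * x - t * b) * (t * x - t * c))
        = chi t * chi ((x - a) * (x - b) * (x - c))"
      using assms by (simp only: chi_mult[of "t\<^sup>2"] chi_mult[of t] chi_power chi_square) simp
  qed simp
  finally show ?thesis
    by (simp only: sum_distrib_left)
qed

lemma quartic_sum_scale:
  assumes "t \<noteq> 0"
  shows "(\<Sum>x\<in>UNIV. chi (x * (x - t * a) * (x - t * b) * (x - t * c)))
    = (\<Sum>x\<in>UNIV. chi (x * (x - a) * (x - b) * (x - c)))"
proof -
  have "(\<Sum>x\<in>UNIV. chi (x * (x - t * a) * (x - t * b) * (x - t * c)))
      = (\<Sum>x\<in>UNIV. chi (t * x * (t * x - t * a) * (t * x - t * b) * (t * x - t * c)))"
    using sum_affine[OF assms, of "\<lambda>x. chi (x * (x - t * a) * (x - t * b) * (x - t * c))" 0] by simp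
  also have "\<dots> = (\<Sum>x\<in>UNIV. chi (t ^ 4 * (x * (x - a) * (x - b) * (x - c))))"
    by (intro sum.cong refl arg_cong[of _ _ chi]) algebra
  also have "\<dots> = (\<Sum>x\<in>UNIV. chi (x * (x - a) * (x - b) * (x - c)))"
    using assms by (simp only: chi_mult[of "t ^ 4"] chi_power chi_fourth_power mult_1 simp_thms)
  finally show ?thesis .
qed

text \<open>Inversion sends the root 0 to infinity, fixes 1 and -1, and sends \<open>z\<close> to
  \<open>- z\<close>. The leading coefficient \<open>z\<close> gives the sign, and the extra term at
  0 has character 1.\<close>

lemma quartic_sum_invert:
  assumes "z\<^sup>2 = - 1"
  shows "(\<Sum>x\<in>UNIV. chi (x * (x - 1) * (x + 1) * (x - z)))
    = chi z * (\<Sum>x\<in>UNIV. chi ((x - 1) * (x + 1) * (x + z))) - 1"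
proof -
  have z: "z * z = - 1"
    using assms by (simp add: power2_eq_square)
  have "(\<Sum>x\<in>UNIV. chi (x * (x - 1) * (x + 1) * (x - z)))
      = (\<Sum>x\<in>-{0}. chi (x * (x - 1) * (x + 1) * (x - z)))"
    by (simp add: sum_UNIV_remove[of _ 0])
  also have "\<dots> = (\<Sum>u\<in>-{0}. chi (inverse u * (inverse u - 1) * (inverse u + 1) * (inverse u - z)))"
    by (rule sum_inverse[symmetric])
  also have "\<dots> = (\<Sum>u\<in>-{0}. chi (z * ((u - 1) * (u + 1) * (u + z))))"
  proof (rule sum.cong)
    fix u :: 'a assume "u \<in> - {0}"
    then have u: "u \<noteq> 0" by simp
    have "(1 - u) * (1 + u) * (1 - u * z) = z * ((u - 1) * (u + 1) * (u + z))"
      using z by algebra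
    moreover have "(1 - u) * (1 + u) * (1 - u * z)
        = (u\<^sup>2)\<^sup>2 * (inverse u * (inverse u - 1) * (inverse u + 1) * (inverse u - z))"
      using u by (simp add: field_simps power2_eq_square)
    ultimately have "chi (z * ((u - 1) * (u + 1) * (u + z)))
        = chi ((u\<^sup>2)\<^sup>2) * chi (inverse u * (inverse u - 1) * (inverse u + 1) * (inverse u - z))"
      by (simp only: flip: chi_mult)
    then show "chi (inverse u * (inverse u - 1) * (inverse u + 1) * (inverse u - z))
        = chi (z * ((u - 1) * (u + 1) * (u + z)))"
      using u by (simp add: chi_power chi_fourth_power)
  qed simp
  also have "\<dots> = (\<Sum>u\<in>UNIV. chi (z * ((u - 1) * (u + 1) * (u + z)))) - 1"
    by (simp add: sum_UNIV_remove[of _ 0] z)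
  also have "\<dots> = chi z * (\<Sum>x\<in>UNIV. chi ((x - 1) * (x + 1) * (x + z))) - 1"
    by (simp only: chi_mult[of z] sum_distrib_left)
  finally show ?thesis .
qed

lemma square_root_minus_one_neq:
  fixes z :: 'a
  assumes "z * z = - 1"
  shows "1 \<noteq> z" "- 1 \<noteq> z" "1 \<noteq> - z" "- 1 \<noteq> - z" "z \<noteq> - z"
proof -
  have "- z * - z = - 1"
    using assms by simp
  then show "1 \<noteq> z" "- 1 \<noteq> z" "1 \<noteq> - z" "- 1 \<noteq> - z"
    using assms neg_1_neq_1 by force+
  show "z \<noteq> - z"
    using assms two_neq_0 by (auto simp: eq_neg_iff_add_eq_0 simp flip: mult_2)
qed

text \<open>Of the 32 terms, the ten quadratic ones contribute -10 and the five quartic ones a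
  further -5. The quartics also add one U and four times \<open>chi z * T\<close>, which combine
  with the cubic terms \<open>- U - chi z * U\<close> and
  \<open>- 2 * (1 + chi z) * T\<close>.\<close>

lemma sum_product_five:
  assumes z2: "z\<^sup>2 = - 1"
  shows "(\<Sum>x\<in>UNIV. (1 - chi x) * (1 - chi (x - 1)) * (1 - chi (x + 1)) * (1 - chi (x - z)) * (1 - chi (x + z)))
    = int q - 15 - chi z * (\<Sum>x\<in>UNIV. chi (x * (x\<^sup>2 - 1))) - (\<Sum>x\<in>UNIV. chi (x * (x ^ 4 - 1)))
      + (2 * chi z - 2) * (\<Sum>x\<in>UNIV. chi ((x - 1) * (x + 1) * (x + z)))
      - 2 * (1 + chi z) * (\<Sum>x\<in>UNIV. chi (x * (x - 1) * (x - z)))"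
proof -
  have zz: "z * z = - 1"
    using z2 by (simp add: power2_eq_square)
  have "z \<noteq> 0"
    using zz by auto
  then have cc: "chi z * (chi z * t) = t" for t
    by (simp add: chi_mult_self flip: mult.assoc)
  define S where "S g = (\<Sum>x\<in>UNIV. chi (g x))" for g :: "'a \<Rightarrow> 'a"
  define U where "U = S (\<lambda>x. x * (x\<^sup>2 - 1))"
  define V where "V = S (\<lambda>x. x * (x ^ 4 - 1))"
  define T where "T = S (\<lambda>x. (x - 1) * (x + 1) * (x + z))"
  define T' where "T' = S (\<lambda>x. x * (x - 1) * (x - z))"
  note distinct = neg_1_neq_1[symmetric] square_root_minus_one_neq[OF zz]
  have lin: "S (\<lambda>x. x) = 0" "S (\<lambda>x. x - a) = 0" "S (\<lambda>x. x + a) = 0" for a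
    using sum_chi sum_chi_linear[of 1 a] sum_chi_linear[of 1 "- a"] by (simp_all add: S_def)
  have quad: "S (\<lambda>x. (x - a) * (x - b)) = - 1" if "a \<noteq> b" for a b
    using sum_chi_quadratic[of 1 1 a b] that by (auto simp: S_def)
  have quads: "S (\<lambda>x. x * (x - 1)) = - 1" "S (\<lambda>x. x * (x + 1)) = - 1"
    "S (\<lambda>x. x * (x - z)) = - 1" "S (\<lambda>x. x * (x + z)) = - 1"
    "S (\<lambda>x. (x - 1) * (x + 1)) = - 1" "S (\<lambda>x. (x - 1) * (x - z)) = - 1"
    "S (\<lambda>x. (x - 1) * (x + z)) = - 1" "S (\<lambda>x. (x + 1) * (x - z)) = - 1"
    "S (\<lambda>x. (x + 1) * (x + z)) = - 1" "S (\<lambda>x. (x - z) * (x + z)) = - 1"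
    using quad[of 0 1] quad[of 0 "- 1"] quad[of 0 z] quad[of 0 "- z"] quad[of 1 "- 1"] quad[of 1 z]
      quad[of 1 "- z"] quad[of "- 1" z] quad[of "- 1" "- z"] quad[of z "- z"] distinct \<open>z \<noteq> 0\<close>
    by simp_all
  \<comment> \<open>Multiplication by \<open>z\<close> cycles 1, \<open>z\<close>, -1,
    \<open>- z\<close>, so triples of roots in one orbit have sums differing only by powers of
    \<open>chi z\<close>.\<close>
  have rot3: "S (\<lambda>x. (x - z * a) * (x - z * b) * (x - z * c)) = chi z * S (\<lambda>x. (x - a) * (x - b) * (x - c))"
    for a b c
    unfolding S_def by (rule cubic_sum_scale) fact
  have cubics_U: "S (\<lambda>x. x * (x - 1) * (x + 1)) = U" "S (\<lambda>x. x * (x - z) * (x + z)) = chi z * U"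
  proof -
    show U: "S (\<lambda>x. x * (x - 1) * (x + 1)) = U"
      unfolding U_def by (rule arg_cong[of _ _ S]) (simp add: fun_eq_iff algebra_simps power2_eq_square)
    show "S (\<lambda>x. x * (x - z) * (x + z)) = chi z * U"
      using rot3[of 0 1 "- 1"] by (simp add: U)
  qed
  have cubics_T': "S (\<lambda>x. x * (x - 1) * (x - z)) = T'" "S (\<lambda>x. x * (x + 1) * (x - z)) = chi z * T'"
    "S (\<lambda>x. x * (x + 1) * (x + z)) = T'" "S (\<lambda>x. x * (x - 1) * (x + z)) = chi z * T'"
    using rot3[of 0 1 z] rot3[of 0 z "- 1"] rot3[of 0 "- 1" "- z"] 
    by (simp_all add: T'_def zz cc mult_ac)
  have cubics_T: "S (\<lambda>x. (x - 1) * (x + 1) * (x + z)) = T" "S (\<lambda>x. (x - 1) * (x - z) * (x + z)) = chi z * T"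
    "S (\<lambda>x. (x - 1) * (x + 1) * (x - z)) = T" "S (\<lambda>x. (x + 1) * (x - z) * (x + z)) = chi z * T"
    using rot3[of 1 "- 1" "- z"] rot3[of z "- z" 1] rot3[of "- 1" 1 z] 
    by (simp_all add: T_def zz cc mult_ac)
  have rot4: "S (\<lambda>x. x * (x - z * a) * (x - z * b) * (x - z * c)) = S (\<lambda>x. x * (x - a) * (x - b) * (x - c))"
    for a b c
    unfolding S_def by (rule quartic_sum_scale) fact
  have quartics: "S (\<lambda>x. x * (x - 1) * (x + 1) * (x - z)) = chi z * T - 1"
    "S (\<lambda>x. x * (x + 1) * (x - z) * (x + z)) = chi z * T - 1"
    "S (\<lambda>x. x * (x - 1) * (x + 1) * (x + z)) = chi z * T - 1"
    "S (\<lambda>x. x * (x - 1) * (x - z) * (x + z)) = chi z * T - 1"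
    using quartic_sum_invert[OF z2] rot4[of 1 "- 1" z] rot4[of z "- z" "- 1"] rot4[of "- 1" 1 "- z"]
    by (simp_all add: T_def S_def zz mult_ac)
  note x4 = product_fourth_roots_of_unity[OF zz]
  have x5: "x * (x - 1) * (x + 1) * (x - z) * (x + z) = x * (x ^ 4 - 1)" for x
    by (simp only: mult.assoc flip: x4)
  have quintics: "S (\<lambda>x. (x - 1) * (x + 1) * (x - z) * (x + z)) = U - 1"
    "S (\<lambda>x. x * (x - 1) * (x + 1) * (x - z) * (x + z)) = V"
    unfolding x4 x5 using sum_chi_fourth_power by (simp_all add: S_def U_def V_def)
  have expand: "(1 - a) * (1 - b) * (1 - c) * (1 - d) * (1 - e)
    = 1 - a - b - c - d - e
      + a * b + a * c + a * d + a * e + b * c + b * d + b * e + c * d + c * e + d * e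
      - a * b * c - a * b * d - a * b * e - a * c * d - a * c * e - a * d * e
      - b * c * d - b * c * e - b * d * e - c * d * e
      + a * b * c * d + a * b * c * e + a * b * d * e + a * c * d * e + b * c * d * e
      - a * b * c * d * e" for a b c d e :: int
    by (simp add: algebra_simps)
  have S: "(\<Sum>x\<in>UNIV. chi (g x)) = S g" for g
    by (simp add: S_def)
  show ?thesis
    unfolding expand sum.distrib sum_subtractf chi_mult[symmetric] S
    unfolding lin quads cubics_U cubics_T cubics_T' quartics quintics U_def[symmetric] V_def[symmetric]
    by (simp add: algebra_simps flip: card_eq)
qed

end

section \<open>Numerical estimate and conclusion\<close>

text \<open>Here \<open>r\<close> is the square root of \<open>q\<close>; \<open>6 * r\<close>
  absorbs the bounds \<open>2 * r\<close> and \<open>4 * r\<close> for U and V, and 15 is the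
  constant of the expansion.\<close>

lemma fourth_power_bound:
  fixes B r :: real
  assumes "B ^ 4 \<le> 6 * (r\<^sup>2) ^ 3" "r > 53"
  shows "4 * \<bar>B\<bar> < r\<^sup>2 - 6 * r - 15"
proof -
  define s where "s = r\<^sup>2 - 6 * r - 15"
  have "53 * r \<le> r\<^sup>2"
    using assms by (simp add: power2_eq_square)
  \<comment> \<open>For \<open>r > 53\<close> the ratio of \<open>s\<close> to
    \<open>r\<^sup>2\<close> exceeds 1 - 6/53 - 15/2809 = 2476/2809, slightly more than
    0.88.\<close>
  then have s: "s \<ge> 22 / 25 * r\<^sup>2" "r\<^sup>2 > 0"
    using assms by (simp_all add: s_def)
  have "(4 * \<bar>B\<bar>) ^ 4 = 256 * B ^ 4"
    by (simp add: power_mult_distrib)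
  also have "\<dots> \<le> 1536 * (r\<^sup>2) ^ 3"
    using assms by simp
  \<comment> \<open>The constant on the right is about 1684, against 1536 = 256 * 6.\<close>
  also have "\<dots> < (22 / 25) ^ 4 * 2809 * (r\<^sup>2) ^ 3"
    using s by (intro mult_strict_right_mono) (simp_all add: power_divide)
  also have "\<dots> \<le> (22 / 25) ^ 4 * r\<^sup>2 * (r\<^sup>2) ^ 3"
    using power_mono[of 53 r 2] assms by (intro mult_right_mono mult_left_mono) simp_all
  also have "\<dots> = (22 / 25 * r\<^sup>2) ^ 4"
    by (simp add: power_mult_distrib eval_nat_numeral)
  also have "\<dots> \<le> s ^ 4"
    using s by (intro power_mono) simp_all
  finally show ?thesis
    unfolding s_def[symmetric] using s by (meson power_less_imp_less_base order.trans mult_nonneg_nonneg less_imp_le zero_le_divide_iff zero_le_numeral)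
qed

theorem theorem2p3:
  fixes q n :: nat
  assumes "q = card (UNIV :: 'a::{finite,field} set)"
    and "q mod 4 = 1"
    and "q > 2809"
    and "n = 1 + (q - 1) div 2"
  shows "\<exists>x::'a. \<not> (\<exists>\<alpha> \<beta>. \<alpha> \<in> kpotents 5 \<and> \<beta> \<in> kpotents n \<and> x = \<alpha> + \<beta>)"
proof (rule ccontr)
  assume contra: "\<not> ?thesis"
  interpret field_1_mod_4 q "TYPE('a)"
    by standard fact+
  obtain z :: 'a where z: "z\<^sup>2 = - 1"
    using exists_square_root_minus_one by blast
  then have zz: "z * z = - 1"
    by (simp add: power2_eq_square)
  then have "z \<noteq> 0" by auto
  \<comment> \<open>That \<open>2 * z\<close> is a square makes the product vanish at
    \<open>z\<close> and \<open>- z\<close>, as the case \<beta> = 0 requires.\<close>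
  have "2 * z = (1 + z)\<^sup>2"
    using zz by (simp add: power2_eq_square algebra_simps)
  moreover have "2 * z \<noteq> 0"
    using two_neq_0 \<open>z \<noteq> 0\<close> by simp
  ultimately have chi_2z: "chi (2 * z) = 1"
    by (metis chi_eq_0_iff chi_power chi_square)
  define P where "P x = (1 - chi x) * (1 - chi (x - 1)) * (1 - chi (x + 1)) * (1 - chi (x - z)) * (1 - chi (x + z))"
    for x
  have P_0: "P x = 0" for x
  proof -
    obtain \<alpha> \<beta> where ab: "\<alpha> ^ 5 = \<alpha>" "\<beta> ^ n = \<beta>" "x = \<alpha> + \<beta>"
      using contra unfolding kpotents_def by blast
    have "\<alpha> * ((\<alpha> - 1) * (\<alpha> + 1) * (\<alpha> - z) * (\<alpha> + z)) = \<alpha> ^ 5 - \<alpha>"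
      unfolding product_fourth_roots_of_unity[OF zz] by (simp add: eval_nat_numeral algebra_simps)
    then have "\<alpha> * ((\<alpha> - 1) * (\<alpha> + 1) * (\<alpha> - z) * (\<alpha> + z)) = 0"
      using ab(1) by simp
    then have \<alpha>: "\<alpha> \<in> {0, 1, - 1, z, - z}"
      by (auto simp: eq_neg_iff_add_eq_0)
    show ?thesis
    proof (cases "\<beta> = 0")
      case True
      then show ?thesis
        using \<alpha> ab(3) chi_2z chi_neg_1 chi_minus[of "2 * z"] by (auto simp: P_def simp flip: mult_2)
    next
      case False
      then have "chi (x - \<alpha>) = 1"
        using ab chi_half_power assms(4) by simp
      then show ?thesis
        using \<alpha> by (auto simp: P_def)
    qed
  qed
  define U where "U = (\<Sum>x\<in>UNIV. chi (x * (x\<^sup>2 - 1)))"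
  define V where "V = (\<Sum>x\<in>UNIV. chi (x * (x ^ 4 - 1)))"
  define T where "T = (\<Sum>x\<in>UNIV. chi ((x - 1) * (x + 1) * (x + z)))"
  define T' where "T' = (\<Sum>x\<in>UNIV. chi (x * (x - 1) * (x - z)))"
  have "(\<Sum>x\<in>UNIV. P x) = int q - 15 - chi z * U - V + (2 * chi z - 2) * T - 2 * (1 + chi z) * T'"
    unfolding P_def U_def V_def T_def T'_def by (rule sum_product_five[OF z])
  then have eq_0: "0 = int q - 15 - chi z * U - V + (2 * chi z - 2) * T - 2 * (1 + chi z) * T'"
    by (simp only: P_0 sum.neutral_const)
  \<comment> \<open>The sign of \<open>chi z\<close> removes one of the two cubic sums: only
    \<open>T'\<close> survives for 1, only \<open>T\<close> for -1.\<close>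
  have "int q \<le> 15 + \<bar>U\<bar> + \<bar>V\<bar> + 4 * max \<bar>T\<bar> \<bar>T'\<bar>"
  proof -
    consider "chi z = 1" | "chi z = - 1"
      using chi_cases[OF \<open>z \<noteq> 0\<close>] by blast
    then show ?thesis
    proof cases
      case 1
      have "int q - 15 - chi z * U - V + (2 * chi z - 2) * T - 2 * (1 + chi z) * T'
          = int q - 15 - U - V - 4 * T'"
        by (simp add: 1)
      then have "int q = 15 + U + V + 4 * T'"
        using eq_0 by linarith
      moreover have "T' \<le> max \<bar>T\<bar> \<bar>T'\<bar>"
        by (simp add: le_max_iff_disj abs_ge_self)
      ultimately show ?thesis by linarith
    next
      case 2
      have "int q - 15 - chi z * U - V + (2 * chi z - 2) * T - 2 * (1 + chi z) * T'
          = int q - 15 + U - V - 4 * T"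
        by (simp add: 2)
      then have "int q = 15 - U + V + 4 * T"
        using eq_0 by linarith
      moreover have "T \<le> max \<bar>T\<bar> \<bar>T'\<bar>"
        by (simp add: le_max_iff_disj abs_ge_self)
      ultimately show ?thesis by linarith
    qed
  qed
  then have "real_of_int (int q) \<le> real_of_int (15 + \<bar>U\<bar> + \<bar>V\<bar> + 4 * max \<bar>T\<bar> \<bar>T'\<bar>)"
    by (simp only: of_int_le_iff)
  moreover define r where "r = sqrt (real q)"
  ultimately have le: "r\<^sup>2 \<le> 15 + \<bar>real_of_int U\<bar> + \<bar>real_of_int V\<bar>
      + 4 * max \<bar>real_of_int T\<bar> \<bar>real_of_int T'\<bar>"
    by (simp add: r_def of_int_max)
  have r: "r > 53"
    unfolding r_def using assms(3) by (intro real_less_rsqrt) simp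
  have r2: "r\<^sup>2 = real q"
    by (simp add: r_def)
  have "U\<^sup>2 \<le> 2\<^sup>2 * int q" "V\<^sup>2 \<le> 4\<^sup>2 * int q"
    using twisted_sum_square_le[of 2] twisted_sum_square_le[of 4] by (simp_all add: U_def V_def)
  then have "real_of_int (U\<^sup>2) \<le> real_of_int (2\<^sup>2 * int q)" "real_of_int (V\<^sup>2) \<le> real_of_int (4\<^sup>2 * int q)"
    by (simp_all only: of_int_le_iff)
  then have "(real_of_int U)\<^sup>2 \<le> (2 * r)\<^sup>2" "(real_of_int V)\<^sup>2 \<le> (4 * r)\<^sup>2"
    by (simp_all add: power_mult_distrib r2)
  then have "\<bar>real_of_int U\<bar> \<le> \<bar>2 * r\<bar>" "\<bar>real_of_int V\<bar> \<le> \<bar>4 * r\<bar>"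
    by (simp_all only: abs_le_square_iff)
  then have U: "\<bar>real_of_int U\<bar> \<le> 2 * r" and V: "\<bar>real_of_int V\<bar> \<le> 4 * r"
    using r by simp_all
  have bound: "4 * \<bar>real_of_int W\<bar> < r\<^sup>2 - 6 * r - 15" if "W ^ 4 \<le> 6 * int q ^ 3" for W
  proof (rule fourth_power_bound[OF _ r])
    have "real_of_int (W ^ 4) \<le> real_of_int (6 * int q ^ 3)"
      using that by (simp only: of_int_le_iff)
    then show "real_of_int W ^ 4 \<le> 6 * (r\<^sup>2) ^ 3"
      by (simp add: r2)
  qed
  note neq = square_root_minus_one_neq[OF zz]
  have "4 * \<bar>real_of_int T\<bar> < r\<^sup>2 - 6 * r - 15"
    using bound[of T] cubic_sum_bound[of 1 "- 1" "- z"] neq neg_1_neq_1 by (auto simp: T_def)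
  moreover have "4 * \<bar>real_of_int T'\<bar> < r\<^sup>2 - 6 * r - 15"
    using bound[of T'] cubic_sum_bound[of 0 1 z] neq \<open>z \<noteq> 0\<close> by (auto simp: T'_def)
  ultimately show False
    using le U V by linarith
qed

end
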